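(* Let $M$ be a simplicial complex whose geometric realization $|M|$ is a homology-manifold with boundary $\partial M$. Assume that $M$ is rimmed, meaning that if $\sigma$ is a face of $M$, then $\sigma\cap|\partial M|$ is a face of $M$. Then deleting any collection of (nonempty) boundary simplices from $M$ results in a simplicial subcomplex whose (reduced) homology is canonically isomorphic (via the inclusion) to that of $M$.
   Context: A simplicial complex is a collection of finite subsets (faces, simplices) of a vertex set, closed under taking subsets; it is identified with its geometric realization, and the empty set counts as a face (so an empty intersection $\sigma\cap|\partial M|$ is a face). The link of a face $\sigma$ is $\mathrm{link}_M(\sigma)=\{\tau\in M\mid\tau\cup\sigma\in M,\ \tau\cap\sigma=\varnothing\}$. A simplicial homology-manifold-with-boundary of dimension $d$ is a simplicial complex whose maximal faces all have dimension $d$ and such that the link of each $i$-face ($0\le i\le d$) has the homology of either a ball or a sphere of dimension $d-i-1$ (the complex $\{\varnothing\}$ being the sphere of dimension $-1$). Its boundary $\partial M$ is the subcomplex whose nonempty faces (the boundary simplices) are those whose link has the homology of a ball. To delete a simplex $\sigma$ from $M$ means to remove from $M$ every simplex containing $\sigma$. *)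

theory Defs
  imports "HOL-Algebra.Algebra" Complex_Main
begin

section \<open>Simplicial complexes\<close>

definition simplicial_complex :: "'a set set \<Rightarrow> bool"
  where "simplicial_complex K \<longleftrightarrow>
    {} \<in> K \<and> (\<forall>\<sigma>\<in>K. finite \<sigma>) \<and> (\<forall>\<sigma>\<in>K. \<forall>\<tau>. \<tau> \<subseteq> \<sigma> \<longrightarrow> \<tau> \<in> K)"

definition face_dim :: "'a set \<Rightarrow> int"
  where "face_dim \<sigma> = int (card \<sigma>) - 1"

definition link :: "'a set set \<Rightarrow> 'a set \<Rightarrow> 'a set set"
  where "link K \<sigma> = {\<tau> \<in> K. \<tau> \<union> \<sigma> \<in> K \<and> \<tau> \<inter> \<sigma> = {}}"

text \<open>Points of the realization are given by their barycentric coordinates. A simplex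
  \<open>\<sigma>\<close>, regarded as a subset of it, is \<open>realization (Pow \<sigma>)\<close>.\<close>

definition realization :: "'a set set \<Rightarrow> ('a \<Rightarrow> real) set"
  where "realization K =
    {x. (\<forall>v. 0 \<le> x v) \<and> {v. x v \<noteq> 0} \<in> K \<and> (\<Sum>v | x v \<noteq> 0. x v) = 1}"

definition delete_simplices :: "'a set set \<Rightarrow> 'a set set \<Rightarrow> 'a set set"
  where "delete_simplices K S = {\<tau> \<in> K. \<forall>\<sigma>\<in>S. \<not> \<sigma> \<subseteq> \<tau>}"


section \<open>Reduced simplicial homology with integer coefficients\<close>

text \<open>Simplices are oriented by an arbitrary but fixed linear order on the type of vertices.
  As a single order serves all complexes over the type, chains on a subcomplex literally are
  chains on the complex. The empty face generates the chains of degree \<open>-1\<close>, so that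
  the boundary of a vertex is its augmentation and the complex \<open>{{}}\<close> has homology
  \<open>\<int>\<close> in degree \<open>-1\<close>.\<close>

definition vertex_order :: "'a rel"
  where "vertex_order = (SOME r. linear_order r)"

lemma linear_order_vertex_order: "linear_order (vertex_order :: 'a rel)"
proof -
  have "\<exists>r :: 'a rel. linear_order r"
    using well_order_on[where A = "UNIV :: 'a set"] unfolding well_order_on_def by iprover
  then show ?thesis
    unfolding vertex_order_def by (rule someI_ex)
qed

definition position :: "'a \<Rightarrow> 'a set \<Rightarrow> nat"
  where "position v \<sigma> = card {u \<in> \<sigma>. (u, v) \<in> vertex_order \<and> u \<noteq> v}"

definition simplex_boundary :: "'a set \<Rightarrow> 'a set \<Rightarrow>\<^sub>0 int"
  where "simplex_boundary \<sigma> =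
    (\<Sum>v\<in>\<sigma>. frag_cmul ((-1) ^ position v \<sigma>) (frag_of (\<sigma> - {v})))"

definition chain_boundary :: "('a set \<Rightarrow>\<^sub>0 int) \<Rightarrow> 'a set \<Rightarrow>\<^sub>0 int"
  where "chain_boundary = frag_extend simplex_boundary"

definition chain_group :: "int \<Rightarrow> 'a set set \<Rightarrow> ('a set \<Rightarrow>\<^sub>0 int) monoid"
  where "chain_group p K = free_Abelian_group {\<sigma> \<in> K. face_dim \<sigma> = p}"

definition cycles :: "int \<Rightarrow> 'a set set \<Rightarrow> ('a set \<Rightarrow>\<^sub>0 int) set"
  where "cycles p K = {c \<in> carrier (chain_group p K). chain_boundary c = 0}"

definition boundaries :: "int \<Rightarrow> 'a set set \<Rightarrow> ('a set \<Rightarrow>\<^sub>0 int) set"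
  where "boundaries p K = chain_boundary ` carrier (chain_group (p + 1) K)"

definition cycle_group :: "int \<Rightarrow> 'a set set \<Rightarrow> ('a set \<Rightarrow>\<^sub>0 int) monoid"
  where "cycle_group p K = subgroup_generated (chain_group p K) (cycles p K)"

definition reduced_homology :: "int \<Rightarrow> 'a set set \<Rightarrow> ('a set \<Rightarrow>\<^sub>0 int) set monoid"
  where "reduced_homology p K = cycle_group p K Mod boundaries p K"

text \<open>The map induced by the inclusion of a subcomplex \<open>L\<close> of \<open>K\<close>: a homology class
  \<open>h\<close> of \<open>L\<close> is a coset of cycles, each of which represents the same class of \<open>K\<close>.\<close>

definition homology_inclusion ::
    "int \<Rightarrow> 'a set set \<Rightarrow> 'a set set \<Rightarrow> ('a set \<Rightarrow>\<^sub>0 int) set \<Rightarrow> ('a set \<Rightarrow>\<^sub>0 int) set"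
  where "homology_inclusion p L K h =
    (\<Union>c\<in>h. boundaries p K #>\<^bsub>cycle_group p K\<^esub> c)"


section \<open>Homology manifolds with boundary\<close>

definition has_homology_of_ball :: "'a set set \<Rightarrow> bool"
  where "has_homology_of_ball K \<longleftrightarrow> (\<forall>p. trivial_group (reduced_homology p K))"

definition has_homology_of_sphere :: "int \<Rightarrow> 'a set set \<Rightarrow> bool"
  where "has_homology_of_sphere n K \<longleftrightarrow>
    reduced_homology n K \<cong> integer_group \<and>
    (\<forall>p. p \<noteq> n \<longrightarrow> trivial_group (reduced_homology p K))"

text \<open>The reduced homology of a ball vanishes whatever its dimension. The bound on the dimension of
  faces is not implied by the condition on maximal faces, since an infinite complex may have
  faces that lie in no maximal face.\<close>

definition homology_manifold :: "int \<Rightarrow> 'a set set \<Rightarrow> bool"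
  where "homology_manifold d M \<longleftrightarrow>
    simplicial_complex M \<and>
    (\<forall>\<sigma>\<in>M. face_dim \<sigma> \<le> d) \<and>
    (\<forall>\<sigma>\<in>M. (\<forall>\<tau>\<in>M. \<sigma> \<subseteq> \<tau> \<longrightarrow> \<tau> = \<sigma>) \<longrightarrow> face_dim \<sigma> = d) \<and>
    (\<forall>\<sigma>\<in>M. \<sigma> \<noteq> {} \<longrightarrow>
      has_homology_of_ball (link M \<sigma>) \<or>
      has_homology_of_sphere (d - face_dim \<sigma> - 1) (link M \<sigma>))"

definition manifold_boundary :: "'a set set \<Rightarrow> 'a set set"
  where "manifold_boundary M = {\<sigma> \<in> M. \<sigma> = {} \<or> has_homology_of_ball (link M \<sigma>)}"

definition rimmed :: "'a set set \<Rightarrow> bool"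
  where "rimmed M \<longleftrightarrow>
    (\<forall>\<sigma>\<in>M. \<exists>\<tau>\<in>M.
      realization (Pow \<sigma>) \<inter> realization (manifold_boundary M) = realization (Pow \<tau>))"

end

(* Let V be the set of boundary vertices. Rimmedness says that for every face t of M the
   intersection of t with V is empty or a boundary face, so the deleted faces are exactly those
   whose intersection with V contains a member of S. For a boundary face r let W r be the relative
   chain complex spanned by the faces that meet V exactly in r. All faces containing r span a
   shifted copy of the chains of the link of r, which is acyclic; those among them that meet V in
   more than r span an acyclic quotient, by downward induction on the size of r. Hence W r is
   acyclic. The deleted part of M is filtered by the size of r with the direct sums of the W r as
   graded pieces, so it is acyclic as well. *)
theory Submission
  imports Defs
begin

section \<open>Simplicial chains\<close>

text \<open>The obstacle is overlap: the star of a single boundary face is easy to remove, but stars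
  of different members of \<open>S\<close> intersect. Sorting simplices by their trace on
  \<open>V\<close> cuts the deleted part into disjoint pieces. The acyclicity of the pieces and the
  filtration argument are proved in one induction. Its claim speaks of all families of boundary
  faces with more than \<open>n - k\<close> vertices at once, so that both the boundary faces
  properly above a given one and the next stage of the filtration are instances of the induction
  hypothesis. The dimension bound supplies the \<open>n\<close> at which it starts. \<open>M\<close>
  may be infinite, so a graded piece may have infinitely many summands. A chain meets only finitely
  many of them, and they are cleared one at a time. \<open>manifold_boundary\<close> is defined face
  by face through links, which does not visibly make it closed under subsets. Rimmedness provides
  this too, when it is applied to a boundary face itself.\<close>

abbreviation simplex_chains :: "int \<Rightarrow> 'a set set \<Rightarrow> ('a set \<Rightarrow>\<^sub>0 int) set"
  where "simplex_chains p K \<equiv> carrier (chain_group p K)"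

lemma chains_iff: "c \<in> simplex_chains p K \<longleftrightarrow> Poly_Mapping.keys c \<subseteq> {\<sigma> \<in> K. face_dim \<sigma> = p}"
  by (simp add: chain_group_def)

lemma chains_zero [simp]: "0 \<in> simplex_chains p K"
  by (simp add: chains_iff)

lemma chains_add: "a \<in> simplex_chains p K \<Longrightarrow> b \<in> simplex_chains p K \<Longrightarrow> a + b \<in> simplex_chains p K"
  unfolding chains_iff by (meson Un_least keys_add order_trans)

lemma chains_diff: "a \<in> simplex_chains p K \<Longrightarrow> b \<in> simplex_chains p K \<Longrightarrow> a - b \<in> simplex_chains p K"
  unfolding chains_iff by (meson Un_least keys_diff order_trans)

lemma chains_uminus: "a \<in> simplex_chains p K \<Longrightarrow> - a \<in> simplex_chains p K"
  unfolding chains_iff by simp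

lemma chains_mono: "K \<subseteq> L \<Longrightarrow> c \<in> simplex_chains p K \<Longrightarrow> c \<in> simplex_chains p L"
  unfolding chains_iff by blast

lemma chain_boundary_zero [simp]: "chain_boundary 0 = 0"
  by (simp add: chain_boundary_def)

lemma chain_boundary_add: "chain_boundary (a + b) = chain_boundary a + chain_boundary b"
  by (simp add: chain_boundary_def frag_extend_add)

lemma chain_boundary_diff: "chain_boundary (a - b) = chain_boundary a - chain_boundary b"
  by (simp add: chain_boundary_def frag_extend_diff)

lemma chain_boundary_uminus: "chain_boundary (- a) = - chain_boundary a"
  by (simp add: chain_boundary_def frag_extend_minus)

lemma chain_boundary_sum: "finite I \<Longrightarrow> chain_boundary (sum f I) = (\<Sum>i\<in>I. chain_boundary (f i))"
  by (simp add: chain_boundary_def frag_extend_sum o_def)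

lemma chain_boundary_cmul: "chain_boundary (frag_cmul k c) = frag_cmul k (chain_boundary c)"
  by (simp add: chain_boundary_def frag_extend_cmul)

lemma chain_boundary_of [simp]: "chain_boundary (frag_of \<sigma>) = simplex_boundary \<sigma>"
  by (simp add: chain_boundary_def)

lemma simplicial_complexD:
  assumes "simplicial_complex K"
  shows "{} \<in> K" "\<sigma> \<in> K \<Longrightarrow> finite \<sigma>" "\<sigma> \<in> K \<Longrightarrow> \<tau> \<subseteq> \<sigma> \<Longrightarrow> \<tau> \<in> K"
  using assms unfolding simplicial_complex_def by blast+

lemma keys_simplex_boundary:
  "Poly_Mapping.keys (simplex_boundary \<sigma>) \<subseteq> (\<lambda>v. \<sigma> - {v}) ` \<sigma>"
  unfolding simplex_boundary_def
  by (rule order_trans[OF keys_sum]) auto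

lemma face_dim_remove: "finite \<sigma> \<Longrightarrow> v \<in> \<sigma> \<Longrightarrow> face_dim (\<sigma> - {v}) = face_dim \<sigma> - 1"
  unfolding face_dim_def by (metis card_Suc_Diff1 add_diff_cancel_left' of_nat_Suc)

lemma keys_chain_boundary:
  assumes "\<tau> \<in> Poly_Mapping.keys (chain_boundary c)"
  obtains \<sigma> v where "\<sigma> \<in> Poly_Mapping.keys c" "v \<in> \<sigma>" "\<tau> = \<sigma> - {v}"
  using assms keys_frag_extend[of simplex_boundary c] keys_simplex_boundary
  unfolding chain_boundary_def by blast

text \<open>Arbitrary families are allowed so that the complement of an upward closed set of
  simplices is covered as well as a complex.\<close>

lemma chain_boundary_in_chains_of_faces:
  assumes c: "c \<in> simplex_chains p K"
    and faces: "\<And>\<sigma> v. \<sigma> \<in> K \<Longrightarrow> v \<in> \<sigma> \<Longrightarrow> finite \<sigma> \<and> \<sigma> - {v} \<in> L"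
  shows "chain_boundary c \<in> simplex_chains (p - 1) L"
  unfolding chains_iff
proof
  fix \<tau> assume "\<tau> \<in> Poly_Mapping.keys (chain_boundary c)"
  then obtain \<sigma> v where \<sigma>: "\<sigma> \<in> Poly_Mapping.keys c" "v \<in> \<sigma>" "\<tau> = \<sigma> - {v}"
    by (rule keys_chain_boundary)
  then have "\<sigma> \<in> K" "face_dim \<sigma> = p"
    using c by (auto simp: chains_iff)
  then show "\<tau> \<in> {\<sigma> \<in> L. face_dim \<sigma> = p - 1}"
    using \<sigma> faces by (auto simp: face_dim_remove)
qed

lemma chain_boundary_in_chains:
  assumes "simplicial_complex K" "c \<in> simplex_chains p K"
  shows "chain_boundary c \<in> simplex_chains (p - 1) K"
  using assms(2) by (rule chain_boundary_in_chains_of_faces)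
    (use simplicial_complexD[OF assms(1)] in blast)

section \<open>The boundary of a boundary\<close>

lemma vertex_order_cases:
  assumes "v \<noteq> w"
  shows "(v, w) \<in> vertex_order \<longleftrightarrow> (w, v) \<notin> vertex_order"
proof -
  have "total vertex_order" "antisym vertex_order"
    using linear_order_vertex_order by (auto simp: linear_order_on_def partial_order_on_def)
  then show ?thesis
    using assms by (auto simp: total_on_def dest: antisymD)
qed

lemma position_remove:
  assumes "finite \<sigma>" "v \<in> \<sigma>" "v \<noteq> w"
  shows "position w \<sigma> = position w (\<sigma> - {v}) + (if (v, w) \<in> vertex_order then 1 else 0)"
proof (cases "(v, w) \<in> vertex_order")
  case True
  then have "{u \<in> \<sigma>. (u, w) \<in> vertex_order \<and> u \<noteq> w}
      = insert v {u \<in> \<sigma> - {v}. (u, w) \<in> vertex_order \<and> u \<noteq> w}"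
    using assms by auto
  then show ?thesis
    using True assms unfolding position_def by simp
next
  case False
  then have "{u \<in> \<sigma>. (u, w) \<in> vertex_order \<and> u \<noteq> w}
      = {u \<in> \<sigma> - {v}. (u, w) \<in> vertex_order \<and> u \<noteq> w}"
    by auto
  then show ?thesis
    using False unfolding position_def by simp
qed

lemma position_Un:
  assumes "finite \<sigma>" "finite \<tau>" "\<sigma> \<inter> \<tau> = {}"
  shows "position v (\<sigma> \<union> \<tau>) = position v \<sigma> + position v \<tau>"
proof -
  have "{u \<in> \<sigma> \<union> \<tau>. (u, v) \<in> vertex_order \<and> u \<noteq> v}
      = {u \<in> \<sigma>. (u, v) \<in> vertex_order \<and> u \<noteq> v} \<union> {u \<in> \<tau>. (u, v) \<in> vertex_order \<and> u \<noteq> v}"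
    by blast
  then show ?thesis
    unfolding position_def using assms by (simp add: card_Un_disjoint disjoint_iff)
qed

lemma frag_eq_uminus_self:
  fixes c :: "'b \<Rightarrow>\<^sub>0 int"
  assumes "c = - c"
  shows "c = 0"
proof (rule poly_mapping_eqI)
  fix x
  have "poly_mapping.lookup c x = - poly_mapping.lookup c x"
    by (subst assms) simp
  then show "poly_mapping.lookup c x = poly_mapping.lookup 0 x"
    by simp
qed

text \<open>Removing two vertices in either order gives the same face with opposite signs, because
  only the earlier vertex shifts the position of the other. The antisymmetric double sum equals its
  own negative, and integer chains have no 2-torsion.\<close>

lemma simplex_boundary_boundary:
  assumes fin: "finite \<sigma>"
  shows "chain_boundary (simplex_boundary \<sigma>) = 0"
proof -
  \<comment> \<open>The value 0 on the diagonal lets both sums range over all of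
    \<open>\<sigma>\<close>, so that they can be swapped.\<close>
  define f where "f v w = (if v = w then 0 else
    frag_cmul ((-1) ^ (position v \<sigma> + position w (\<sigma> - {v}))) (frag_of (\<sigma> - {v} - {w})))" for v w
  have anti: "f v w = - f w v" if "v \<in> \<sigma>" "w \<in> \<sigma>" for v w
  proof (cases "v = w")
    case False
    have "(-1 :: int) ^ (position v \<sigma> + position w (\<sigma> - {v}))
        = - ((-1) ^ (position w \<sigma> + position v (\<sigma> - {w})))"
      using position_remove[OF fin that(1) False] position_remove[OF fin that(2), of v] False
        vertex_order_cases[OF False]
      by (auto simp: power_add)
    moreover have "\<sigma> - {v} - {w} = \<sigma> - {w} - {v}"
      by blast
    ultimately show ?thesis
      using False by (simp add: f_def flip: frag_cmul_minus_one)
  qed (simp add: f_def)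
  have "chain_boundary (simplex_boundary \<sigma>)
      = (\<Sum>v\<in>\<sigma>. frag_cmul ((-1) ^ position v \<sigma>) (simplex_boundary (\<sigma> - {v})))"
    by (simp add: simplex_boundary_def[of \<sigma>] fin chain_boundary_sum chain_boundary_cmul)
  also have "\<dots> = (\<Sum>v\<in>\<sigma>. \<Sum>w\<in>\<sigma> - {v}. f v w)"
    unfolding simplex_boundary_def frag_cmul_sum frag_cmul_cmul o_def
    by (intro sum.cong refl) (auto simp: f_def power_add)
  also have "\<dots> = (\<Sum>v\<in>\<sigma>. \<Sum>w\<in>\<sigma>. f v w)"
    using fin by (intro sum.cong sum.mono_neutral_left) (auto simp: f_def)
  finally have eq: "chain_boundary (simplex_boundary \<sigma>) = (\<Sum>v\<in>\<sigma>. \<Sum>w\<in>\<sigma>. f v w)" .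
  have "(\<Sum>v\<in>\<sigma>. \<Sum>w\<in>\<sigma>. f v w) = (\<Sum>w\<in>\<sigma>. \<Sum>v\<in>\<sigma>. f v w)"
    by (rule sum.swap)
  also have "\<dots> = - (\<Sum>w\<in>\<sigma>. \<Sum>v\<in>\<sigma>. f w v)"
    unfolding sum_negf[symmetric] by (intro sum.cong refl anti)
  finally show ?thesis
    using eq frag_eq_uminus_self by metis
qed

lemma chain_boundary_boundary:
  assumes "Poly_Mapping.keys c \<subseteq> {\<sigma>. finite \<sigma>}"
  shows "chain_boundary (chain_boundary c) = 0"
  using assms
  by (induction c rule: frag_induction) (simp_all add: simplex_boundary_boundary chain_boundary_diff)

lemma chain_boundary_boundary_complex:
  assumes "simplicial_complex K" "c \<in> simplex_chains p K"
  shows "chain_boundary (chain_boundary c) = 0"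
  using assms by (intro chain_boundary_boundary) (auto simp: chains_iff simplicial_complexD)

section \<open>Relative acyclicity\<close>

text \<open>Vanishing of the relative homology of the pair, expressed through relative cycles so that no
  quotient of chain groups is needed.\<close>

definition relatively_acyclic :: "'a set set \<Rightarrow> 'a set set \<Rightarrow> bool"
  where "relatively_acyclic K L \<longleftrightarrow>
    (\<forall>p. \<forall>c\<in>simplex_chains p K. chain_boundary c \<in> simplex_chains (p - 1) L \<longrightarrow>
      (\<exists>b\<in>simplex_chains (p + 1) K. c - chain_boundary b \<in> simplex_chains p L))"

section \<open>Exactness, excision and direct sums\<close>

lemma relatively_acyclicD:
  assumes "relatively_acyclic K L" "c \<in> simplex_chains p K" "chain_boundary c \<in> simplex_chains (p - 1) L"
  obtains b where "b \<in> simplex_chains (p + 1) K" "c - chain_boundary b \<in> simplex_chains p L"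
  using assms unfolding relatively_acyclic_def by blast

lemma relatively_acyclic_refl: "relatively_acyclic K K"
  unfolding relatively_acyclic_def by (auto intro!: bexI[of _ 0])

text \<open>Exactness for a triple: a filler modulo \<open>N\<close> leaves a relative cycle of
  \<open>N\<close> modulo \<open>L\<close>, whose own filler is added to the first.\<close>

lemma relatively_acyclic_trans:
  assumes KN: "relatively_acyclic K N" and NL: "relatively_acyclic N L"
    and K: "simplicial_complex K" and sub: "L \<subseteq> N" "N \<subseteq> K"
  shows "relatively_acyclic K L"
  unfolding relatively_acyclic_def
proof (intro allI ballI impI)
  fix p c assume c: "c \<in> simplex_chains p K" and dc: "chain_boundary c \<in> simplex_chains (p - 1) L"
  obtain b where b: "b \<in> simplex_chains (p + 1) K" "c - chain_boundary b \<in> simplex_chains p N"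
    using relatively_acyclicD[OF KN c chains_mono[OF sub(1) dc]] .
  have "chain_boundary (c - chain_boundary b) \<in> simplex_chains (p - 1) L"
    using dc chain_boundary_boundary_complex[OF K b(1)] by (simp add: chain_boundary_diff)
  then obtain b' where b': "b' \<in> simplex_chains (p + 1) N"
      "c - chain_boundary b - chain_boundary b' \<in> simplex_chains p L"
    using relatively_acyclicD[OF NL b(2)] by blast
  then show "\<exists>b\<in>simplex_chains (p + 1) K. c - chain_boundary b \<in> simplex_chains p L"
    using b chains_mono[OF sub(2) b'(1)]
    by (intro bexI[of _ "b + b'"]) (simp_all add: chains_add chain_boundary_add diff_diff_eq)
qed

text \<open>Another place in the long exact sequence of the triple: the homology of
  \<open>(N, L)\<close> in degree p sits between that of \<open>(K, N)\<close> in degree p + 1 and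
  that of \<open>(K, L)\<close> in degree p.\<close>

lemma relatively_acyclic_intermediate:
  assumes KL: "relatively_acyclic K L" and KN: "relatively_acyclic K N"
    and K: "simplicial_complex K" and sub: "L \<subseteq> N" "N \<subseteq> K"
  shows "relatively_acyclic N L"
  unfolding relatively_acyclic_def
proof (intro allI ballI impI)
  fix p c assume c: "c \<in> simplex_chains p N" and dc: "chain_boundary c \<in> simplex_chains (p - 1) L"
  obtain b where b: "b \<in> simplex_chains (p + 1) K" "c - chain_boundary b \<in> simplex_chains p L"
    using relatively_acyclicD[OF KL chains_mono[OF sub(2) c] dc] .
  \<comment> \<open>As \<open>L\<close> lies in \<open>N\<close>, the boundary of the filler
    \<open>b\<close> lies in \<open>N\<close>. Hence \<open>b\<close> is a relative cycle modulo
    \<open>N\<close> and can be moved into \<open>N\<close> without changing its boundary.\<close>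
  have "c - (c - chain_boundary b) \<in> simplex_chains p N"
    using c chains_mono[OF sub(1) b(2)] by (rule chains_diff)
  then have "chain_boundary b \<in> simplex_chains (p + 1 - 1) N"
    by simp
  then obtain b' where b': "b' \<in> simplex_chains (p + 1 + 1) K" "b - chain_boundary b' \<in> simplex_chains (p + 1) N"
    using relatively_acyclicD[OF KN b(1)] by blast
  have "chain_boundary (b - chain_boundary b') = chain_boundary b"
    using chain_boundary_boundary_complex[OF K b'(1)] by (simp add: chain_boundary_diff)
  then show "\<exists>b\<in>simplex_chains (p + 1) N. c - chain_boundary b \<in> simplex_chains p L"
    using b(2) b'(2) by (intro bexI[of _ "b - chain_boundary b'"]) simp_all
qed

lemma chains_split:
  assumes "c \<in> simplex_chains p K"
  obtains a b where "a \<in> simplex_chains p (K \<inter> W)" "b \<in> simplex_chains p (K - W)" "a + b = c"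
proof -
  have "Poly_Mapping.keys c \<subseteq> {\<sigma> \<in> K \<inter> W. face_dim \<sigma> = p} \<union> {\<sigma> \<in> K - W. face_dim \<sigma> = p}"
    using assms by (auto simp: chains_iff)
  then show ?thesis
    using that by (elim frag_split) (simp add: chains_iff)
qed

text \<open>Relative chains see only the simplices in the difference of the two complexes, so a
  relative cycle and its filler can be carried across by their parts in that difference.\<close>

lemma relatively_acyclic_excision:
  assumes K: "simplicial_complex K" and L: "simplicial_complex L"
    and K': "simplicial_complex K'" and L': "simplicial_complex L'"
    and sub: "L \<subseteq> K" "L' \<subseteq> K'" and eq: "K - L = K' - L'"
    and acyclic: "relatively_acyclic K' L'"
  shows "relatively_acyclic K L"
  unfolding relatively_acyclic_def
proof (intro allI ballI impI)
  fix p c assume c: "c \<in> simplex_chains p K" and dc: "chain_boundary c \<in> simplex_chains (p - 1) L"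
  obtain c0 c1 where c01: "c0 \<in> simplex_chains p (K \<inter> L)" "c1 \<in> simplex_chains p (K - L)" "c0 + c1 = c"
    using chains_split[OF c] by blast
  have c1: "c1 = c - c0"
    using c01 by auto
  have c0L: "c0 \<in> simplex_chains p L"
    using c01(1) by (rule chains_mono[rotated]) simp
  have c1K': "c1 \<in> simplex_chains p K'"
    using c01(2) by (rule chains_mono[rotated]) (simp add: eq)
  have "chain_boundary c1 \<in> simplex_chains (p - 1) L"
    unfolding c1 chain_boundary_diff using chains_diff[OF dc chain_boundary_in_chains[OF L c0L]] .
  moreover have "chain_boundary c1 \<in> simplex_chains (p - 1) K'"
    using chain_boundary_in_chains[OF K' c1K'] .
  \<comment> \<open>A simplex of \<open>K'\<close> outside \<open>L'\<close> would belong to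
    \<open>K - L\<close> and so not to \<open>L\<close>.\<close>
  ultimately have "chain_boundary c1 \<in> simplex_chains (p - 1) L'"
    using eq unfolding chains_iff by blast
  then obtain b where b: "b \<in> simplex_chains (p + 1) K'" "c1 - chain_boundary b \<in> simplex_chains p L'"
    using relatively_acyclicD[OF acyclic c1K'] by blast
  obtain b0 b1 where b01: "b0 \<in> simplex_chains (p + 1) (K' \<inter> L')" "b1 \<in> simplex_chains (p + 1) (K' - L')" "b0 + b1 = b"
    using chains_split[OF b(1)] by blast
  have b0L': "b0 \<in> simplex_chains (p + 1) L'"
    using b01(1) by (rule chains_mono[rotated]) simp
  have b1K: "b1 \<in> simplex_chains (p + 1) K"
    using b01(2) by (rule chains_mono[rotated]) (simp flip: eq)
  \<comment> \<open>Only the part \<open>b1\<close> of the filler lives in \<open>K\<close>;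
    dropping \<open>b0\<close> costs a boundary inside \<open>L'\<close>.\<close>
  have "c1 - chain_boundary b1 = c1 - chain_boundary b + chain_boundary b0"
    using b01(3) by (auto simp: chain_boundary_add)
  also have "\<dots> \<in> simplex_chains p L'"
    using b(2) chain_boundary_in_chains[OF L' b0L'] by (intro chains_add) simp_all
  finally have "c1 - chain_boundary b1 \<in> simplex_chains p L'" .
  moreover have "c1 - chain_boundary b1 \<in> simplex_chains p K"
    using chain_boundary_in_chains[OF K b1K] chains_mono[OF _ c01(2), of K]
    by (intro chains_diff) auto
  ultimately have "c1 - chain_boundary b1 \<in> simplex_chains p L"
    using eq unfolding chains_iff by blast
  then have "c0 + (c1 - chain_boundary b1) \<in> simplex_chains p L"
    using c0L by (rule chains_add[rotated])
  then show "\<exists>b\<in>simplex_chains (p + 1) K. c - chain_boundary b \<in> simplex_chains p L"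
    using b1K c01(3) by (intro bexI[of _ b1]) (simp_all add: add_diff_eq)
qed

text \<open>The index set may be infinite, so the induction is on the number of simplices of the
  chain that lie in the pieces. Upward closure and disjointness ensure that the boundary of a chain
  supported in one piece never enters another, so clearing one piece does not disturb the
  rest.\<close>

lemma relatively_acyclic_disjoint_union:
  assumes K: "simplicial_complex K"
    and W: "\<And>i. i \<in> I \<Longrightarrow> relatively_acyclic K (K - W i)"
    and up: "\<And>i \<sigma> \<tau>. i \<in> I \<Longrightarrow> \<sigma> \<in> W i \<Longrightarrow> \<sigma> \<subseteq> \<tau> \<Longrightarrow> \<tau> \<in> K \<Longrightarrow> \<tau> \<in> W i"
    and disj: "\<And>i j. i \<in> I \<Longrightarrow> j \<in> I \<Longrightarrow> i \<noteq> j \<Longrightarrow> W i \<inter> W j = {}"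
  shows "relatively_acyclic K (K - (\<Union>i\<in>I. W i))"
  unfolding relatively_acyclic_def
proof (intro allI ballI impI)
  fix p c
  define A where "A c = {\<sigma> \<in> Poly_Mapping.keys c. \<sigma> \<in> (\<Union>i\<in>I. W i)}" for c :: "'a set \<Rightarrow>\<^sub>0 int"
  assume "c \<in> simplex_chains p K" "chain_boundary c \<in> simplex_chains (p - 1) (K - (\<Union>i\<in>I. W i))"
  then show "\<exists>b\<in>simplex_chains (p + 1) K. c - chain_boundary b \<in> simplex_chains p (K - (\<Union>i\<in>I. W i))"
  proof (induction "card (A c)" arbitrary: c rule: less_induct)
    case less
    note c = less.prems(1) and dc = less.prems(2)
    show ?case
    proof (cases "A c = {}")
      case True
      then have "c \<in> simplex_chains p (K - (\<Union>i\<in>I. W i))"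
        using c by (auto simp: chains_iff A_def)
      then show ?thesis
        by (intro bexI[of _ 0]) simp_all
    next
      case False
      then obtain \<sigma> i where i: "i \<in> I" "\<sigma> \<in> W i" "\<sigma> \<in> Poly_Mapping.keys c"
        by (auto simp: A_def)
      have "chain_boundary c \<in> simplex_chains (p - 1) (K - W i)"
        using dc by (rule chains_mono[rotated]) (use i in auto)
      then obtain b where b: "b \<in> simplex_chains (p + 1) K" "c - chain_boundary b \<in> simplex_chains p (K - W i)"
        using relatively_acyclicD[OF W[OF i(1)] c] by blast
      obtain b0 b1 where b01: "b0 \<in> simplex_chains (p + 1) (K \<inter> W i)" "b1 \<in> simplex_chains (p + 1) (K - W i)" "b0 + b1 = b"
        using chains_split[OF b(1)] .
      have b0K: "b0 \<in> simplex_chains (p + 1) K"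
        using b01(1) by (rule chains_mono[rotated]) simp
      \<comment> \<open>Only the part \<open>b0\<close> of the filler inside \<open>W i\<close> is
        used, which controls the simplices it introduces. The discarded \<open>b1\<close> has its
        boundary outside \<open>W i\<close>, since \<open>W i\<close> is upward closed.\<close>
      have "chain_boundary b1 \<in> simplex_chains (p + 1 - 1) (K - W i)"
        using b01(2)
      proof (rule chain_boundary_in_chains_of_faces)
        fix \<sigma> v assume "\<sigma> \<in> K - W i" "v \<in> \<sigma>"
        then show "finite \<sigma> \<and> \<sigma> - {v} \<in> K - W i"
          using simplicial_complexD[OF K] up[OF i(1), of "\<sigma> - {v}" \<sigma>] by blast
      qed
      then have "c - chain_boundary b + chain_boundary b1 \<in> simplex_chains p (K - W i)"
        using b(2) by (intro chains_add) simp_all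
      moreover define c' where "c' = c - chain_boundary b0"
      ultimately have c': "c' \<in> simplex_chains p (K - W i)"
        using b01(3) by (auto simp: chain_boundary_add)
      have c'K: "c' \<in> simplex_chains p K"
        using c' by (rule chains_mono[rotated]) simp
      have dc': "chain_boundary c' = chain_boundary c"
        using chain_boundary_boundary_complex[OF K b0K] by (simp add: c'_def chain_boundary_diff)
      have "A c' \<subset> A c"
      proof
        show "A c' \<subseteq> A c"
        proof
          fix \<tau> assume "\<tau> \<in> A c'"
          then obtain j where j: "\<tau> \<in> Poly_Mapping.keys c'" "j \<in> I" "\<tau> \<in> W j"
            by (auto simp: A_def)
          have "\<tau> \<notin> W i"
            using j(1) c' by (auto simp: chains_iff)
          \<comment> \<open>Otherwise \<open>\<tau>\<close>, which lies in \<open>W j\<close> with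
            \<open>j \<noteq> i\<close>, would be below a simplex of \<open>W i\<close>, and upward
            closure would put that simplex in \<open>W j\<close> too.\<close>
          have "\<tau> \<notin> Poly_Mapping.keys (chain_boundary b0)"
          proof
            assume "\<tau> \<in> Poly_Mapping.keys (chain_boundary b0)"
            then obtain \<sigma> v where "\<sigma> \<in> Poly_Mapping.keys b0" "\<tau> = \<sigma> - {v}"
              by (rule keys_chain_boundary)
            then have "\<sigma> \<in> K" "\<sigma> \<in> W i" "\<tau> \<subseteq> \<sigma>"
              using b01(1) by (auto simp: chains_iff)
            then show False
              using up[OF j(2,3)] disj[OF i(1) j(2)] \<open>\<tau> \<notin> W i\<close> j(3) by blast
          qed
          then have "\<tau> \<in> Poly_Mapping.keys c"
            using j(1) keys_diff[of c "chain_boundary b0"] unfolding c'_def by blast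
          then show "\<tau> \<in> A c"
            using j by (auto simp: A_def)
        qed
        have "\<sigma> \<in> A c" "\<sigma> \<notin> A c'"
          using i c' by (auto simp: A_def chains_iff)
        then show "A c' \<noteq> A c"
          by blast
      qed
      then have "card (A c') < card (A c)"
        by (rule psubset_card_mono[rotated]) (simp add: A_def)
      then obtain b' where "b' \<in> simplex_chains (p + 1) K"
          "c' - chain_boundary b' \<in> simplex_chains p (K - (\<Union>i\<in>I. W i))"
        using less.hyps[of c'] c'K dc dc' by auto
      then show ?thesis
        using b0K by (intro bexI[of _ "b0 + b'"])
          (simp_all add: chains_add chain_boundary_add c'_def diff_diff_eq)
    qed
  qed
qed

section \<open>Deleting families of faces\<close>

lemma simplicial_complex_delete_simplices:
  assumes "simplicial_complex K" "{} \<notin> S"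
  shows "simplicial_complex (delete_simplices K S)"
  unfolding simplicial_complex_def
proof (intro conjI ballI allI impI)
  show "{} \<in> delete_simplices K S"
    using simplicial_complexD(1)[OF assms(1)] assms(2) by (auto simp: delete_simplices_def)
next
  fix \<sigma> assume "\<sigma> \<in> delete_simplices K S"
  then show "finite \<sigma>"
    using simplicial_complexD(2)[OF assms(1)] by (simp add: delete_simplices_def)
next
  fix \<sigma> \<tau> assume "\<sigma> \<in> delete_simplices K S" "\<tau> \<subseteq> \<sigma>"
  then show "\<tau> \<in> delete_simplices K S"
    using simplicial_complexD(3)[OF assms(1), of \<sigma> \<tau>] by (auto simp: delete_simplices_def)
qed

text \<open>The combinatorial core: \<open>B\<close> stands for the nonempty boundary faces and
  \<open>V\<close> for the boundary vertices. The hypothesis \<open>star\<close> handles one face;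
  full families follow because every nonempty trace on \<open>V\<close> is again in
  \<open>B\<close>.\<close>

lemma relatively_acyclic_delete_simplices:
  assumes M: "simplicial_complex M" and card: "\<And>\<sigma>. \<sigma> \<in> M \<Longrightarrow> card \<sigma> \<le> n"
    and B: "B \<subseteq> M - {{}}"
    and star: "\<And>\<rho>. \<rho> \<in> B \<Longrightarrow> relatively_acyclic M (delete_simplices M {\<rho>})"
    and V: "\<And>\<rho>. \<rho> \<in> B \<Longrightarrow> \<rho> \<subseteq> V" "\<And>\<sigma>. \<sigma> \<in> M \<Longrightarrow> \<sigma> \<inter> V \<noteq> {} \<Longrightarrow> \<sigma> \<inter> V \<in> B"
    and T: "T \<subseteq> B"
  shows "relatively_acyclic M (delete_simplices M T)"
proof -
  have fin: "finite \<sigma>" if "\<sigma> \<in> M" for \<sigma>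
    using simplicial_complexD(2)[OF M that] .
  \<comment> \<open>The bound means more than \<open>n - k\<close> vertices, written additively to
    avoid truncated subtraction. It excludes every face at \<open>k = 0\<close> and none at
    \<open>k = Suc n\<close>.\<close>
  have "relatively_acyclic M (delete_simplices M T)"
    if "T \<subseteq> B" "\<forall>\<rho>\<in>T. n < card \<rho> + k" for k T
    using that
  proof (induction k arbitrary: T)
    case 0
    then have "T = {}"
      using card B by (auto simp: subset_iff not_less[symmetric])
    then show ?case
      by (simp add: delete_simplices_def relatively_acyclic_refl)
  next
    case (Suc k)
    \<comment> \<open>\<open>T'\<close> takes all large faces of \<open>B\<close> above members of
      \<open>T\<close>, not just those in \<open>T\<close>. These delete nothing beyond what
      \<open>T\<close> deletes, and after their removal a simplex containing some
      \<open>\<rho> \<in> I\<close> has trace exactly \<open>\<rho>\<close>. This makes each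
      \<open>W \<rho>\<close> upward closed in \<open>N\<close>.\<close>
    define T' where "T' = {\<sigma> \<in> B. (\<exists>\<rho>\<in>T. \<rho> \<subseteq> \<sigma>) \<and> n < card \<sigma> + k}"
    define I where "I = {\<rho> \<in> T. n = card \<rho> + k}"
    define N where "N = delete_simplices M T'"
    define W where "W \<rho> = {\<tau> \<in> M. \<tau> \<inter> V = \<rho>}" for \<rho>
    have N: "simplicial_complex N"
      unfolding N_def T'_def using M B by (intro simplicial_complex_delete_simplices) auto
    have larger: "n < card \<sigma> + k" if "\<rho> \<in> I" "\<sigma> \<in> B" "\<rho> \<subset> \<sigma>" for \<rho> \<sigma>
      using that psubset_card_mono[of \<sigma> \<rho>] fin B by (auto simp: I_def)
    have up: "\<tau> \<in> W \<rho>" if "\<rho> \<in> I" "\<sigma> \<in> W \<rho>" "\<sigma> \<subseteq> \<tau>" "\<tau> \<in> N" for \<rho> \<sigma> \<tau>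
    proof -
      have sub: "\<rho> \<subseteq> \<tau> \<inter> V" and \<tau>: "\<tau> \<in> M"
        using that by (auto simp: W_def N_def delete_simplices_def)
      have \<rho>: "\<rho> \<in> T" "\<rho> \<noteq> {}"
        using that(1) Suc.prems(1) B by (auto simp: I_def)
      then have \<sigma>: "\<tau> \<inter> V \<in> B"
        using V(2)[OF \<tau>] sub by blast
      have "\<tau> \<inter> V \<notin> T'"
        using that(4) unfolding N_def delete_simplices_def by blast
      then have "\<not> n < card (\<tau> \<inter> V) + k"
        using \<sigma> \<rho>(1) sub unfolding T'_def by blast
      then have "\<tau> \<inter> V = \<rho>"
        using larger[OF that(1) \<sigma>] sub by blast
      then show ?thesis
        using \<tau> by (simp add: W_def)
    qed
    have NL: "N - (\<Union>\<rho>\<in>I. W \<rho>) = delete_simplices M T"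
    proof (intro equalityI subsetI)
      fix \<tau> assume \<tau>: "\<tau> \<in> N - (\<Union>\<rho>\<in>I. W \<rho>)"
      have "\<not> \<rho> \<subseteq> \<tau>" if \<rho>: "\<rho> \<in> T" for \<rho>
      proof
        assume "\<rho> \<subseteq> \<tau>"
        have \<tau>M: "\<tau> \<in> M"
          using \<tau> by (simp add: N_def delete_simplices_def)
        have sub: "\<rho> \<subseteq> \<tau> \<inter> V" "\<rho> \<noteq> {}"
          using \<open>\<rho> \<subseteq> \<tau>\<close> \<rho> V(1) Suc.prems(1) B by blast+
        then have \<sigma>: "\<tau> \<inter> V \<in> B"
          using V(2)[OF \<tau>M] by blast
        moreover have "\<tau> \<inter> V \<notin> T'"
          using \<tau> unfolding N_def delete_simplices_def by blast
        ultimately have le: "\<not> n < card (\<tau> \<inter> V) + k"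
          using \<rho> sub unfolding T'_def by blast
        \<comment> \<open>The trace has at most \<open>n - k\<close> vertices and members of
          \<open>T\<close> have at least that many, so \<open>\<rho>\<close> is the whole
          trace.\<close>
        have "card \<rho> \<le> card (\<tau> \<inter> V)"
          using sub fin[OF \<tau>M] by (intro card_mono) auto
        then have "\<rho> \<in> I"
          using le \<rho> Suc.prems(2) by (fastforce simp: I_def)
        then have "\<tau> \<in> W \<rho>"
          using larger[OF _ \<sigma>] le sub \<tau>M by (auto simp: W_def)
        then show False
          using \<tau> \<open>\<rho> \<in> I\<close> by blast
      qed
      then show "\<tau> \<in> delete_simplices M T"
        using \<tau> by (auto simp: N_def delete_simplices_def)
    next
      fix \<tau> assume \<tau>: "\<tau> \<in> delete_simplices M T"
      have "\<tau> \<in> N"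
        using \<tau> unfolding N_def T'_def delete_simplices_def by blast
      moreover have "\<tau> \<notin> W \<rho>" if "\<rho> \<in> I" for \<rho>
        using \<tau> that by (auto simp: W_def I_def delete_simplices_def)
      ultimately show "\<tau> \<in> N - (\<Union>\<rho>\<in>I. W \<rho>)"
        by blast
    qed
    have layer: "relatively_acyclic N (N - W \<rho>)" if \<rho>: "\<rho> \<in> I" for \<rho>
    proof -
      \<comment> \<open>The difference of this pair is \<open>W \<rho>\<close>. Both members are
        relatively acyclic in \<open>M\<close>: \<open>K'\<close> by the induction hypothesis, as
        proper superfaces of \<open>\<rho>\<close> have more vertices, and \<open>L'\<close> by
        \<open>star\<close>.\<close>
      define K' where "K' = delete_simplices M {\<sigma> \<in> B. \<rho> \<subset> \<sigma>}"
      define L' where "L' = delete_simplices M {\<rho>}"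
      have \<rho>B: "\<rho> \<in> B" "\<rho> \<noteq> {}"
        using \<rho> Suc.prems(1) B by (auto simp: I_def)
      have K': "simplicial_complex K'" and L': "simplicial_complex L'"
        unfolding K'_def L'_def using M \<rho>B by (auto intro!: simplicial_complex_delete_simplices)
      have L'K': "L' \<subseteq> K'"
        unfolding K'_def L'_def delete_simplices_def by blast
      have "relatively_acyclic M K'"
        unfolding K'_def using larger[OF \<rho>] by (intro Suc.IH) auto
      moreover have "relatively_acyclic M L'"
        unfolding L'_def using star[OF \<rho>B(1)] .
      moreover have "K' \<subseteq> M"
        by (auto simp: K'_def delete_simplices_def)
      ultimately have acyclic: "relatively_acyclic K' L'"
        using relatively_acyclic_intermediate M L'K' by blast
      have W': "K' - L' = W \<rho>"
      proof (intro equalityI subsetI)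
        fix \<tau> assume "\<tau> \<in> K' - L'"
        then have \<tau>: "\<tau> \<in> M" "\<rho> \<subseteq> \<tau>" "\<And>\<sigma>. \<sigma> \<in> B \<Longrightarrow> \<rho> \<subset> \<sigma> \<Longrightarrow> \<not> \<sigma> \<subseteq> \<tau>"
          by (auto simp: K'_def L'_def delete_simplices_def)
        have sub: "\<rho> \<subseteq> \<tau> \<inter> V"
          using V(1)[OF \<rho>B(1)] \<tau>(2) by blast
        then have "\<tau> \<inter> V \<in> B"
          using V(2)[OF \<tau>(1)] \<rho>B(2) by blast
        then have "\<not> \<rho> \<subset> \<tau> \<inter> V"
          using \<tau>(3) by blast
        then show "\<tau> \<in> W \<rho>"
          using sub \<tau>(1) by (auto simp: W_def)
      next
        fix \<tau> assume "\<tau> \<in> W \<rho>"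
        then have \<tau>: "\<tau> \<in> M" "\<tau> \<inter> V = \<rho>"
          by (auto simp: W_def)
        have "\<not> \<sigma> \<subseteq> \<tau>" if "\<sigma> \<in> B" "\<rho> \<subset> \<sigma>" for \<sigma>
          using V(1)[OF that(1)] that(2) \<tau>(2) by blast
        then show "\<tau> \<in> K' - L'"
          using \<tau> by (auto simp: K'_def L'_def delete_simplices_def)
      qed
      have "W \<rho> \<subseteq> N"
      proof
        fix \<tau> assume \<tau>: "\<tau> \<in> W \<rho>"
        have "\<not> \<sigma> \<subseteq> \<tau>" if \<sigma>: "\<sigma> \<in> T'" for \<sigma>
        proof
          assume "\<sigma> \<subseteq> \<tau>"
          then have "\<sigma> \<subseteq> \<rho>"
            using \<tau> \<sigma> V(1)[of \<sigma>] by (auto simp: W_def T'_def)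
          then have "card \<sigma> \<le> card \<rho>"
            using \<rho>B B fin by (intro card_mono) auto
          then show False
            using \<sigma> \<rho> by (simp add: T'_def I_def)
        qed
        then show "\<tau> \<in> N"
          using \<tau> by (auto simp: N_def W_def delete_simplices_def)
      qed
      then have eq: "N - (N - W \<rho>) = K' - L'"
        using W' by blast
      have "{} \<notin> W \<rho>"
        using \<rho>B(2) by (auto simp: W_def)
      have "simplicial_complex (N - W \<rho>)"
        unfolding simplicial_complex_def
      proof (intro conjI ballI allI impI)
        show "{} \<in> N - W \<rho>"
          using simplicial_complexD(1)[OF N] \<open>{} \<notin> W \<rho>\<close> by blast
      next
        fix \<sigma> assume "\<sigma> \<in> N - W \<rho>"
        then show "finite \<sigma>"
          using simplicial_complexD(2)[OF N] by blast
      next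
        fix \<sigma> \<tau> assume "\<sigma> \<in> N - W \<rho>" "\<tau> \<subseteq> \<sigma>"
        then show "\<tau> \<in> N - W \<rho>"
          using simplicial_complexD(3)[OF N, of \<sigma> \<tau>] up[OF \<rho>, of \<tau> \<sigma>] by blast
      qed
      then show ?thesis
        by (rule relatively_acyclic_excision[OF N _ K' L' Diff_subset L'K' eq acyclic])
    qed
    have "relatively_acyclic N (N - (\<Union>\<rho>\<in>I. W \<rho>))"
    proof (rule relatively_acyclic_disjoint_union[OF N])
      fix \<rho> assume "\<rho> \<in> I"
      then show "relatively_acyclic N (N - W \<rho>)"
        by (rule layer)
    next
      fix \<rho> \<sigma> \<tau> assume "\<rho> \<in> I" "\<sigma> \<in> W \<rho>" "\<sigma> \<subseteq> \<tau>" "\<tau> \<in> N"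
      then show "\<tau> \<in> W \<rho>"
        by (rule up)
    next
      fix \<rho> \<rho>' :: "'a set" assume "\<rho> \<noteq> \<rho>'"
      then show "W \<rho> \<inter> W \<rho>' = {}"
        by (auto simp: W_def)
    qed
    then have "relatively_acyclic N (delete_simplices M T)"
      by (simp only: NL)
    moreover have "relatively_acyclic M N"
      unfolding N_def by (rule Suc.IH) (auto simp: T'_def)
    moreover have "delete_simplices M T \<subseteq> N"
      unfolding NL[symmetric] by (rule Diff_subset)
    moreover have "N \<subseteq> M"
      by (auto simp: N_def delete_simplices_def)
    ultimately show ?case
      using relatively_acyclic_trans M by blast
  qed
  from this[OF T, of "Suc n"] show ?thesis
    by simp
qed

section \<open>Chains of a link\<close>

text \<open>The sign of the shuffle that moves \<open>\<rho>\<close> past \<open>\<tau>\<close>; it makes \<open>link_chain\<close> commute with the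
  boundary.\<close>

definition join_sign :: "'a set \<Rightarrow> 'a set \<Rightarrow> int"
  where "join_sign \<rho> \<tau> = (\<Prod>v\<in>\<tau>. (-1) ^ position v \<rho>)"

text \<open>A right inverse of \<open>link_chain\<close> on chains of the link. The boundary of a
  join also contains faces that omit a vertex of \<open>\<rho>\<close>, so this is a chain map only
  modulo those.\<close>

definition join_chain :: "'a set \<Rightarrow> ('a set \<Rightarrow>\<^sub>0 int) \<Rightarrow> 'a set \<Rightarrow>\<^sub>0 int"
  where "join_chain \<rho> = frag_extend (\<lambda>\<tau>. frag_cmul (join_sign \<rho> \<tau>) (frag_of (\<tau> \<union> \<rho>)))"

text \<open>The value 0 makes this the projection to chains modulo the simplices that do not contain
  \<open>\<rho>\<close>, identified with chains of the link in degree lower by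
  \<open>card \<rho>\<close>.\<close>

definition link_chain :: "'a set \<Rightarrow> ('a set \<Rightarrow>\<^sub>0 int) \<Rightarrow> 'a set \<Rightarrow>\<^sub>0 int"
  where "link_chain \<rho> = frag_extend (\<lambda>\<sigma>. if \<rho> \<subseteq> \<sigma>
    then frag_cmul (join_sign \<rho> (\<sigma> - \<rho>)) (frag_of (\<sigma> - \<rho>)) else 0)"

lemma join_sign_square: "join_sign \<rho> \<tau> * join_sign \<rho> \<tau> = 1"
  unfolding join_sign_def prod.distrib[symmetric]
  by (intro prod.neutral) (simp flip: power_mult_distrib)

lemma join_sign_remove:
  assumes "finite \<tau>" "v \<in> \<tau>"
  shows "join_sign \<rho> \<tau> = (-1) ^ position v \<rho> * join_sign \<rho> (\<tau> - {v})"
  unfolding join_sign_def using prod.remove[OF assms] by simp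

text \<open>Removing a vertex of \<open>\<rho>\<close> gives a face that \<open>link_chain\<close>
  kills. For any other vertex v the position in \<open>\<sigma>\<close> exceeds that in
  \<open>\<sigma> - \<rho>\<close> by \<open>position v \<rho>\<close>, exactly the factor by which
  \<open>join_sign\<close> changes.\<close>

lemma link_chain_simplex_boundary:
  assumes fin: "finite \<sigma>"
  shows "link_chain \<rho> (simplex_boundary \<sigma>) = chain_boundary (link_chain \<rho> (frag_of \<sigma>))"
proof -
  have "link_chain \<rho> (simplex_boundary \<sigma>) = (\<Sum>v\<in>\<sigma>. frag_cmul ((-1) ^ position v \<sigma>)
      (if \<rho> \<subseteq> \<sigma> - {v} then frag_cmul (join_sign \<rho> (\<sigma> - {v} - \<rho>)) (frag_of (\<sigma> - {v} - \<rho>)) else 0))"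
    using fin by (simp add: simplex_boundary_def link_chain_def frag_extend_sum o_def frag_extend_cmul
        del: Diff_insert0 subset_Diff_insert)
  also have "\<dots> = chain_boundary (link_chain \<rho> (frag_of \<sigma>))"
  proof (cases "\<rho> \<subseteq> \<sigma>")
    case False
    then show ?thesis
      by (auto simp: link_chain_def intro!: sum.neutral)
  next
    case True
    let ?\<tau> = "\<sigma> - \<rho>"
    have "(\<Sum>v\<in>\<sigma>. frag_cmul ((-1) ^ position v \<sigma>)
        (if \<rho> \<subseteq> \<sigma> - {v} then frag_cmul (join_sign \<rho> (\<sigma> - {v} - \<rho>)) (frag_of (\<sigma> - {v} - \<rho>)) else 0))
      = (\<Sum>v\<in>?\<tau>. frag_cmul ((-1) ^ position v \<sigma>)
        (if \<rho> \<subseteq> \<sigma> - {v} then frag_cmul (join_sign \<rho> (\<sigma> - {v} - \<rho>)) (frag_of (\<sigma> - {v} - \<rho>)) else 0))"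
      using fin by (intro sum.mono_neutral_right) auto
    also have "\<dots> = (\<Sum>v\<in>?\<tau>. frag_cmul (join_sign \<rho> ?\<tau>)
        (frag_cmul ((-1) ^ position v ?\<tau>) (frag_of (?\<tau> - {v}))))"
    proof (rule sum.cong[OF refl])
      fix v assume v: "v \<in> ?\<tau>"
      have "position v \<sigma> = position v ?\<tau> + position v \<rho>"
        using position_Un[of ?\<tau> \<rho> v] fin True by (simp add: Un_absorb2 finite_subset Int_commute)
      moreover have "join_sign \<rho> ?\<tau> = (-1) ^ position v \<rho> * join_sign \<rho> (?\<tau> - {v})"
        using fin v by (intro join_sign_remove) auto
      moreover have "\<sigma> - {v} - \<rho> = ?\<tau> - {v}" "\<rho> \<subseteq> \<sigma> - {v}"
        using v True by auto
      ultimately show "frag_cmul ((-1) ^ position v \<sigma>)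
          (if \<rho> \<subseteq> \<sigma> - {v} then frag_cmul (join_sign \<rho> (\<sigma> - {v} - \<rho>)) (frag_of (\<sigma> - {v} - \<rho>)) else 0)
        = frag_cmul (join_sign \<rho> ?\<tau>) (frag_cmul ((-1) ^ position v ?\<tau>) (frag_of (?\<tau> - {v})))"
        by (simp only: if_True frag_cmul_cmul power_add mult_ac)
    qed
    also have "\<dots> = chain_boundary (link_chain \<rho> (frag_of \<sigma>))"
      using True fin by (simp add: link_chain_def chain_boundary_cmul simplex_boundary_def frag_cmul_sum o_def)
    finally show ?thesis .
  qed
  finally show ?thesis .
qed

lemma link_chain_boundary:
  assumes "Poly_Mapping.keys c \<subseteq> {\<sigma>. finite \<sigma>}"
  shows "link_chain \<rho> (chain_boundary c) = chain_boundary (link_chain \<rho> c)"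
  using assms
proof (induction c rule: frag_induction)
  case (one \<sigma>)
  then show ?case
    by (simp add: link_chain_simplex_boundary)
next
  case (diff a b)
  then show ?case
    by (simp add: chain_boundary_diff link_chain_def frag_extend_diff)
qed (simp add: link_chain_def)

lemma link_chain_join_chain:
  assumes "Poly_Mapping.keys e \<subseteq> {\<tau>. \<tau> \<inter> \<rho> = {}}"
  shows "link_chain \<rho> (join_chain \<rho> e) = e"
  using assms
proof (induction e rule: frag_induction)
  case (one \<tau>)
  then have "\<tau> \<union> \<rho> - \<rho> = \<tau>"
    by blast
  then show ?case
    by (simp add: link_chain_def join_chain_def frag_extend_cmul join_sign_square)
qed (simp_all add: link_chain_def join_chain_def frag_extend_diff)

text \<open>As \<open>join_sign\<close> is a unit, a chain killed by \<open>link_chain\<close> has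
  no simplex containing \<open>\<rho>\<close>; this determines the kernel.\<close>

lemma lookup_link_chain:
  assumes "\<rho> \<subseteq> \<sigma>"
  shows "poly_mapping.lookup (link_chain \<rho> c) (\<sigma> - \<rho>)
    = join_sign \<rho> (\<sigma> - \<rho>) * poly_mapping.lookup c \<sigma>"
  using subset_UNIV
proof (induction c rule: frag_induction)
  case (one \<tau>)
  have "\<tau> - \<rho> = \<sigma> - \<rho> \<longleftrightarrow> \<tau> = \<sigma>" if "\<rho> \<subseteq> \<tau>"
    using that assms by blast
  moreover have "\<tau> \<noteq> \<sigma>" if "\<not> \<rho> \<subseteq> \<tau>"
    using that assms by blast
  ultimately show ?case
    by (auto simp: link_chain_def)
next
  case (diff a b)
  then show ?case
    by (simp add: link_chain_def frag_extend_diff lookup_minus algebra_simps)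
qed (simp add: link_chain_def)

lemma link_chain_in_chains:
  assumes M: "simplicial_complex M" and c: "c \<in> simplex_chains p M"
  shows "link_chain \<rho> c \<in> simplex_chains (p - int (card \<rho>)) (link M \<rho>)"
  unfolding chains_iff
proof
  fix \<tau> assume "\<tau> \<in> Poly_Mapping.keys (link_chain \<rho> c)"
  then obtain \<sigma> where \<sigma>: "\<sigma> \<in> Poly_Mapping.keys c" "\<rho> \<subseteq> \<sigma>" "\<tau> = \<sigma> - \<rho>"
    unfolding link_chain_def by (rule keys_frag_extend[THEN subsetD, THEN UN_E]) (auto split: if_splits)
  then have "\<sigma> \<in> M" "face_dim \<sigma> = p"
    using c by (auto simp: chains_iff)
  moreover from this have "card (\<sigma> - \<rho>) + card \<rho> = card \<sigma>"
    using simplicial_complexD(2)[OF M] \<sigma>(2)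
    by (metis card_Diff_subset card_mono finite_subset le_add_diff_inverse2)
  moreover have "\<sigma> - \<rho> \<in> M"
    using simplicial_complexD(3)[OF M \<open>\<sigma> \<in> M\<close>, of "\<sigma> - \<rho>"] by blast
  ultimately show "\<tau> \<in> {\<sigma> \<in> link M \<rho>. face_dim \<sigma> = p - int (card \<rho>)}"
    using \<sigma> by (auto simp: link_def face_dim_def Un_absorb2)
qed

lemma join_chain_in_chains:
  assumes M: "simplicial_complex M" and e: "e \<in> simplex_chains p (link M \<rho>)"
  shows "join_chain \<rho> e \<in> simplex_chains (p + int (card \<rho>)) M"
  unfolding chains_iff
proof
  fix \<sigma> assume "\<sigma> \<in> Poly_Mapping.keys (join_chain \<rho> e)"
  then obtain \<tau> where \<tau>: "\<tau> \<in> Poly_Mapping.keys e" "\<sigma> = \<tau> \<union> \<rho>"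
    unfolding join_chain_def by (rule keys_frag_extend[THEN subsetD, THEN UN_E]) auto
  then have "\<tau> \<union> \<rho> \<in> M" "\<tau> \<inter> \<rho> = {}" "face_dim \<tau> = p"
    using e by (auto simp: chains_iff link_def)
  moreover from this have "card (\<tau> \<union> \<rho>) = card \<tau> + card \<rho>"
    using simplicial_complexD(2)[OF M] by (intro card_Un_disjoint) auto
  ultimately show "\<sigma> \<in> {\<sigma> \<in> M. face_dim \<sigma> = p + int (card \<rho>)}"
    using \<tau> by (simp add: face_dim_def)
qed

lemma simplicial_complex_link:
  assumes M: "simplicial_complex M" and "\<rho> \<in> M"
  shows "simplicial_complex (link M \<rho>)"
  unfolding simplicial_complex_def
proof (intro conjI ballI allI impI)
  show "{} \<in> link M \<rho>"
    using assms simplicial_complexD(1)[OF M] by (simp add: link_def)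
next
  fix \<sigma> assume "\<sigma> \<in> link M \<rho>"
  then show "finite \<sigma>"
    using simplicial_complexD(2)[OF M] by (simp add: link_def)
next
  fix \<sigma> \<tau> assume \<sigma>: "\<sigma> \<in> link M \<rho>" and \<tau>: "\<tau> \<subseteq> \<sigma>"
  have "\<tau> \<in> M"
    using \<sigma> \<tau> simplicial_complexD(3)[OF M, of \<sigma> \<tau>] by (simp add: link_def)
  moreover have "\<tau> \<union> \<rho> \<in> M"
    using \<sigma> \<tau> simplicial_complexD(3)[OF M, of "\<sigma> \<union> \<rho>" "\<tau> \<union> \<rho>"] by (auto simp: link_def)
  ultimately show "\<tau> \<in> link M \<rho>"
    using \<sigma> \<tau> by (auto simp: link_def)
qed

text \<open>\<open>link_chain\<close> turns a relative cycle into a cycle of the link; a filler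
  there, joined with \<open>\<rho>\<close>, fills the original chain up to simplices that avoid
  \<open>\<rho>\<close> as a face.\<close>

lemma relatively_acyclic_delete_simplex:
  assumes M: "simplicial_complex M" and \<rho>: "\<rho> \<in> M"
    and acyclic: "\<And>p. cycles p (link M \<rho>) \<subseteq> boundaries p (link M \<rho>)"
  shows "relatively_acyclic M (delete_simplices M {\<rho>})"
  unfolding relatively_acyclic_def
proof (intro allI ballI impI)
  fix p c
  assume c: "c \<in> simplex_chains p M"
    and dc: "chain_boundary c \<in> simplex_chains (p - 1) (delete_simplices M {\<rho>})"
  let ?q = "p - int (card \<rho>)"
  have fin: "Poly_Mapping.keys c \<subseteq> {\<sigma>. finite \<sigma>}" if "c \<in> simplex_chains p M" for p c
    using that simplicial_complexD(2)[OF M] by (auto simp: chains_iff)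
  have "link_chain \<rho> (chain_boundary c) = 0"
    unfolding link_chain_def
    using dc by (intro frag_extend_eq_0) (auto simp: chains_iff delete_simplices_def)
  then have "link_chain \<rho> c \<in> cycles ?q (link M \<rho>)"
    using link_chain_in_chains[OF M c] link_chain_boundary[OF fin[OF c], of \<rho>] by (simp add: cycles_def)
  then obtain e where e: "e \<in> simplex_chains (?q + 1) (link M \<rho>)" "link_chain \<rho> c = chain_boundary e"
    using acyclic unfolding boundaries_def by blast
  define b where "b = join_chain \<rho> e"
  have b: "b \<in> simplex_chains (p + 1) M"
    using join_chain_in_chains[OF M e(1)] by (simp add: b_def add.commute)
  \<comment> \<open>Since \<open>link_chain\<close> is a chain map, it sends the boundary of
    \<open>b\<close> to that of \<open>e\<close>, whatever faces missing part of
    \<open>\<rho>\<close> occur in it.\<close>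
  have "link_chain \<rho> b = e"
    unfolding b_def using e(1) by (intro link_chain_join_chain) (auto simp: chains_iff link_def)
  then have "link_chain \<rho> (c - chain_boundary b) = 0"
    using e(2) link_chain_boundary[OF fin[OF b], of \<rho>] by (simp add: link_chain_def frag_extend_diff)
  then have "poly_mapping.lookup (c - chain_boundary b) \<sigma> = 0" if "\<rho> \<subseteq> \<sigma>" for \<sigma>
    using lookup_link_chain[OF that, of "c - chain_boundary b"] join_sign_square[of \<rho> "\<sigma> - \<rho>"] by auto
  moreover have "c - chain_boundary b \<in> simplex_chains p M"
    using chain_boundary_in_chains[OF M b] by (intro chains_diff c) simp
  ultimately have "c - chain_boundary b \<in> simplex_chains p (delete_simplices M {\<rho>})"
    by (auto simp: chains_iff delete_simplices_def in_keys_iff subset_iff)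
  then show "\<exists>b\<in>simplex_chains (p + 1) M. c - chain_boundary b \<in> simplex_chains p (delete_simplices M {\<rho>})"
    using b by blast
qed

section \<open>Homology classes\<close>

lemma mult_chain_group [simp]: "x \<otimes>\<^bsub>chain_group p K\<^esub> y = x + y"
  by (simp add: chain_group_def)

lemma mult_cycle_group [simp]: "x \<otimes>\<^bsub>cycle_group p K\<^esub> y = x + y"
  by (simp add: cycle_group_def)

lemma comm_group_chain_group: "comm_group (chain_group p K)"
  by (simp add: chain_group_def abelian_free_Abelian_group)

lemma inv_chain_group: "x \<in> simplex_chains p K \<Longrightarrow> inv\<^bsub>chain_group p K\<^esub> x = - x"
  by (simp add: chain_group_def)

lemma subgroup_chain_groupI:
  assumes "H \<subseteq> simplex_chains p K" "0 \<in> H"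
    and "\<And>a b. a \<in> H \<Longrightarrow> b \<in> H \<Longrightarrow> a + b \<in> H" "\<And>a. a \<in> H \<Longrightarrow> - a \<in> H"
  shows "subgroup H (chain_group p K)"
  using assms inv_chain_group[of _ p K]
  by (intro group.subgroupI comm_group.axioms(2) comm_group_chain_group) (auto simp: subset_iff)

lemma subgroup_cycles: "subgroup (cycles p K) (chain_group p K)"
  by (rule subgroup_chain_groupI)
    (auto simp: cycles_def chain_boundary_add chain_boundary_uminus intro: chains_add chains_uminus)

lemma subgroup_boundaries:
  assumes "simplicial_complex K"
  shows "subgroup (boundaries p K) (chain_group p K)"
proof (rule subgroup_chain_groupI)
  show "boundaries p K \<subseteq> simplex_chains p K"
    using chain_boundary_in_chains[OF assms, of _ "p + 1"] by (auto simp: boundaries_def)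
  show "0 \<in> boundaries p K"
    unfolding boundaries_def by (rule image_eqI[of _ _ 0]) simp_all
  show "a + b \<in> boundaries p K" if "a \<in> boundaries p K" "b \<in> boundaries p K" for a b
    using that unfolding boundaries_def
    by (auto simp flip: chain_boundary_add intro!: imageI chains_add)
  show "- a \<in> boundaries p K" if "a \<in> boundaries p K" for a
    using that unfolding boundaries_def
    by (auto simp flip: chain_boundary_uminus intro!: imageI chains_uminus)
qed

lemma boundaries_subset_cycles:
  assumes "simplicial_complex K"
  shows "boundaries p K \<subseteq> cycles p K"
  using chain_boundary_in_chains[OF assms, of _ "p + 1"] chain_boundary_boundary_complex[OF assms]
  by (auto simp: boundaries_def cycles_def)

lemma carrier_cycle_group [simp]: "carrier (cycle_group p K) = cycles p K"
  unfolding cycle_group_def by (rule subgroup.carrier_subgroup_generated_subgroup[OF subgroup_cycles])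

lemma normal_boundaries:
  assumes "simplicial_complex K"
  shows "boundaries p K \<lhd> cycle_group p K"
proof -
  interpret G: comm_group "chain_group p K"
    by (rule comm_group_chain_group)
  show ?thesis
    unfolding cycle_group_def
    using G.abelian_subgroup_generated[OF comm_group_chain_group]
    by (rule comm_group.subgroup_imp_normal)
      (rule G.subgroup_of_subgroup_generated[OF boundaries_subset_cycles[OF assms] subgroup_boundaries[OF assms]])
qed

definition homology_class :: "int \<Rightarrow> 'a set set \<Rightarrow> ('a set \<Rightarrow>\<^sub>0 int) \<Rightarrow> ('a set \<Rightarrow>\<^sub>0 int) set"
  where "homology_class p K c = boundaries p K #>\<^bsub>cycle_group p K\<^esub> c"

lemma mem_homology_class: "d \<in> homology_class p K c \<longleftrightarrow> d - c \<in> boundaries p K"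
  by (auto simp: homology_class_def r_coset_def intro: bexI[of _ "d - c"])

lemma homology_class_eq_iff:
  assumes K: "simplicial_complex K"
  shows "homology_class p K c = homology_class p K d \<longleftrightarrow> c - d \<in> boundaries p K"
proof
  have "0 \<in> boundaries p K"
    unfolding boundaries_def by (rule image_eqI[of _ _ 0]) simp_all
  then have "c \<in> homology_class p K c"
    by (simp add: mem_homology_class)
  then show "c - d \<in> boundaries p K" if "homology_class p K c = homology_class p K d"
    using that by (simp add: mem_homology_class)
next
  assume cd: "c - d \<in> boundaries p K"
  note B = subgroup.m_closed[OF subgroup_boundaries[OF K], simplified]
    subgroup.m_inv_closed[OF subgroup_boundaries[OF K]]
  have "- (c - d) \<in> boundaries p K"
    using B(2)[OF cd] subgroup.mem_carrier[OF subgroup_boundaries[OF K] cd] by (simp add: inv_chain_group)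
  then show "homology_class p K c = homology_class p K d"
    using B(1)[OF _ cd] B(1)[of _ p "- (c - d)"] by (fastforce simp: mem_homology_class)
qed

lemma carrier_reduced_homology: "carrier (reduced_homology p K) = homology_class p K ` cycles p K"
  by (simp add: reduced_homology_def carrier_FactGroup homology_class_def[abs_def])

lemma mult_reduced_homology:
  assumes "simplicial_complex K" "c \<in> cycles p K" "d \<in> cycles p K"
  shows "homology_class p K c \<otimes>\<^bsub>reduced_homology p K\<^esub> homology_class p K d = homology_class p K (c + d)"
  using normal.rcos_sum[OF normal_boundaries[OF assms(1)], of c p d] assms
  by (simp add: reduced_homology_def homology_class_def)

text \<open>Boundaries in \<open>L\<close> are boundaries in \<open>K\<close>, so the cosets in the
  defining union coincide; the union is nonempty because \<open>c\<close> represents its own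
  class.\<close>

lemma homology_inclusion_class:
  assumes L: "simplicial_complex L" and K: "simplicial_complex K" and "L \<subseteq> K"
  shows "homology_inclusion p L K (homology_class p L c) = homology_class p K c"
proof -
  have "boundaries p L \<subseteq> boundaries p K"
    using chains_mono[OF \<open>L \<subseteq> K\<close>] by (auto simp: boundaries_def)
  then have "homology_class p K d = homology_class p K c" if "d \<in> homology_class p L c" for d
    using that by (auto simp: homology_class_eq_iff[OF K] mem_homology_class)
  moreover have "c \<in> homology_class p L c"
    using homology_class_eq_iff[OF L, of p c c] by (simp add: mem_homology_class)
  ultimately show ?thesis
    unfolding homology_inclusion_def homology_class_def[symmetric] by blast
qed

text \<open>The long exact sequence of the pair, read off from chains.\<close>

lemma homology_inclusion_iso:
  assumes L: "simplicial_complex L" and K: "simplicial_complex K" and sub: "L \<subseteq> K"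
    and acyclic: "relatively_acyclic K L"
  shows "homology_inclusion p L K \<in> iso (reduced_homology p L) (reduced_homology p K)"
proof -
  note incl = homology_inclusion_class[OF L K sub]
  have cyc: "cycles p L \<subseteq> cycles p K"
    using chains_mono[OF sub] by (auto simp: cycles_def)
  have "homology_inclusion p L K \<in> hom (reduced_homology p L) (reduced_homology p K)"
  proof (rule homI)
    fix h assume "h \<in> carrier (reduced_homology p L)"
    then show "homology_inclusion p L K h \<in> carrier (reduced_homology p K)"
      using cyc by (auto simp: carrier_reduced_homology incl)
  next
    fix h h' assume "h \<in> carrier (reduced_homology p L)" "h' \<in> carrier (reduced_homology p L)"
    then obtain c c' where "c \<in> cycles p L" "h = homology_class p L c"
        "c' \<in> cycles p L" "h' = homology_class p L c'"
      by (auto simp: carrier_reduced_homology)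
    then show "homology_inclusion p L K (h \<otimes>\<^bsub>reduced_homology p L\<^esub> h')
        = homology_inclusion p L K h \<otimes>\<^bsub>reduced_homology p K\<^esub> homology_inclusion p L K h'"
      using cyc by (simp add: mult_reduced_homology[OF L] mult_reduced_homology[OF K] incl subset_iff)
  qed
  moreover have "inj_on (homology_inclusion p L K) (carrier (reduced_homology p L))"
  proof (rule inj_onI)
    fix h h' assume "h \<in> carrier (reduced_homology p L)" "h' \<in> carrier (reduced_homology p L)"
      and eq: "homology_inclusion p L K h = homology_inclusion p L K h'"
    then obtain c c' where c: "c \<in> cycles p L" "h = homology_class p L c"
        "c' \<in> cycles p L" "h' = homology_class p L c'"
      by (auto simp: carrier_reduced_homology)
    then have "c - c' \<in> boundaries p K"
      using eq by (simp add: incl homology_class_eq_iff[OF K])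
    then obtain b where b: "b \<in> simplex_chains (p + 1) K" "c - c' = chain_boundary b"
      by (auto simp: boundaries_def)
    have "c - c' \<in> simplex_chains p L"
      using c by (intro chains_diff) (auto simp: cycles_def)
    \<comment> \<open>A filler in \<open>K\<close> of a chain of \<open>L\<close> is a relative
      cycle one degree higher, so it can be moved into \<open>L\<close> with the same
      boundary.\<close>
    then have "chain_boundary b \<in> simplex_chains (p + 1 - 1) L"
      using b by simp
    then obtain a where a: "a \<in> simplex_chains (p + 1 + 1) K" "b - chain_boundary a \<in> simplex_chains (p + 1) L"
      using relatively_acyclicD[OF acyclic b(1)] by blast
    have "c - c' = chain_boundary (b - chain_boundary a)"
      using b chain_boundary_boundary_complex[OF K a(1)] by (simp add: chain_boundary_diff)
    then have "c - c' \<in> boundaries p L"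
      using a(2) by (simp add: boundaries_def)
    then show "h = h'"
      using c by (simp add: homology_class_eq_iff[OF L])
  qed
  moreover have "homology_inclusion p L K ` carrier (reduced_homology p L) = carrier (reduced_homology p K)"
  proof
    show "homology_inclusion p L K ` carrier (reduced_homology p L) \<subseteq> carrier (reduced_homology p K)"
      using cyc by (auto simp: carrier_reduced_homology incl)
    show "carrier (reduced_homology p K) \<subseteq> homology_inclusion p L K ` carrier (reduced_homology p L)"
    proof
      fix h assume "h \<in> carrier (reduced_homology p K)"
      then obtain c where c: "c \<in> simplex_chains p K" "chain_boundary c = 0" "h = homology_class p K c"
        by (auto simp: carrier_reduced_homology cycles_def)
      then obtain b where b: "b \<in> simplex_chains (p + 1) K" "c - chain_boundary b \<in> simplex_chains p L"
        using relatively_acyclicD[OF acyclic c(1)] by auto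
      have "c - chain_boundary b \<in> cycles p L"
        using b c(2) chain_boundary_boundary_complex[OF K b(1)] by (simp add: cycles_def chain_boundary_diff)
      moreover have "h = homology_class p K (c - chain_boundary b)"
        using b(1) c(3) by (simp add: homology_class_eq_iff[OF K] boundaries_def)
      ultimately show "h \<in> homology_inclusion p L K ` carrier (reduced_homology p L)"
        by (auto simp: carrier_reduced_homology incl image_iff)
    qed
  qed
  ultimately show ?thesis
    by (simp add: iso_def bij_betw_def)
qed

text \<open>The unit of the quotient group is the coset \<open>boundaries p K\<close>
  itself.\<close>

lemma ball_cycles_subset_boundaries:
  assumes K: "simplicial_complex K" and "has_homology_of_ball K"
  shows "cycles p K \<subseteq> boundaries p K"
proof
  fix c assume "c \<in> cycles p K"
  then have "homology_class p K c \<in> carrier (reduced_homology p K)"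
    by (simp add: carrier_reduced_homology)
  then have "homology_class p K c = boundaries p K"
    using assms(2) by (simp add: has_homology_of_ball_def trivial_group_def reduced_homology_def)
  moreover have "c \<in> homology_class p K c"
    using homology_class_eq_iff[OF K, of p c c] by (simp add: mem_homology_class)
  ultimately show "c \<in> boundaries p K"
    by simp
qed

section \<open>Boundary faces of rimmed manifolds\<close>

text \<open>The barycentre of \<open>\<rho>\<close> tests whether \<open>\<rho>\<close> belongs to a
  family, which turns equations between realizations into statements about faces.\<close>

lemma realization_point_with_support:
  assumes "finite \<rho>" "\<rho> \<noteq> {}"
  obtains x where "\<And>K. x \<in> realization K \<longleftrightarrow> \<rho> \<in> K"
proof
  let ?x = "\<lambda>v. if v \<in> \<rho> then 1 / real (card \<rho>) else 0"
  have supp: "{v. ?x v \<noteq> 0} = \<rho>"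
    using assms by auto
  have "(\<Sum>v\<in>\<rho>. ?x v) = 1"
    using assms by simp
  then show "?x \<in> realization K \<longleftrightarrow> \<rho> \<in> K" for K
    unfolding realization_def mem_Collect_eq supp by simp
qed

text \<open>Comparing barycentres on both sides of the rim condition. The empty face is excluded
  because no point has empty support.\<close>

lemma rimmedD:
  assumes M: "simplicial_complex M" and "rimmed M" and \<sigma>: "\<sigma> \<in> M"
  obtains \<tau> where "\<tau> \<in> M"
    "\<And>\<rho>. \<rho> \<noteq> {} \<Longrightarrow> finite \<rho> \<Longrightarrow> \<rho> \<subseteq> \<sigma> \<and> \<rho> \<in> manifold_boundary M \<longleftrightarrow> \<rho> \<subseteq> \<tau>"
proof -
  obtain \<tau> where \<tau>: "\<tau> \<in> M"
      "realization (Pow \<sigma>) \<inter> realization (manifold_boundary M) = realization (Pow \<tau>)"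
    using assms by (auto simp: rimmed_def)
  show thesis
  proof (rule that[OF \<tau>(1)])
    fix \<rho> :: "'a set" assume "\<rho> \<noteq> {}" "finite \<rho>"
    then obtain x where "\<And>K. x \<in> realization K \<longleftrightarrow> \<rho> \<in> K"
      using realization_point_with_support by metis
    then show "\<rho> \<subseteq> \<sigma> \<and> \<rho> \<in> manifold_boundary M \<longleftrightarrow> \<rho> \<subseteq> \<tau>"
      using \<tau>(2) by (metis Int_iff Pow_iff)
  qed
qed

theorem proposition5:
  fixes M :: "'a set set" and S :: "'a set set" and d :: int
  assumes "homology_manifold d M"
    and "rimmed M"
    and "S \<subseteq> manifold_boundary M - {{}}"
  shows "simplicial_complex (delete_simplices M S) \<and>
    delete_simplices M S \<subseteq> M \<and>
    (\<forall>p. homology_inclusion p (delete_simplices M S) M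
      \<in> iso (reduced_homology p (delete_simplices M S)) (reduced_homology p M))"
proof -
  have M: "simplicial_complex M" and dim: "\<And>\<sigma>. \<sigma> \<in> M \<Longrightarrow> face_dim \<sigma> \<le> d"
    using assms(1) by (auto simp: homology_manifold_def)
  have L: "simplicial_complex (delete_simplices M S)"
    using assms(3) by (intro simplicial_complex_delete_simplices M) auto
  have sub: "delete_simplices M S \<subseteq> M"
    by (auto simp: delete_simplices_def)
  define V where "V = {v. {v} \<in> manifold_boundary M}"
  have "relatively_acyclic M (delete_simplices M S)"
  proof (rule relatively_acyclic_delete_simplices[OF M])
    \<comment> \<open>A face of dimension \<open>d\<close> has \<open>d + 1\<close>
      vertices.\<close>
    show "card \<sigma> \<le> nat (d + 1)" if "\<sigma> \<in> M" for \<sigma>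
      using dim[OF that] by (simp add: face_dim_def)
    show "manifold_boundary M - {{}} \<subseteq> M - {{}}"
      by (auto simp: manifold_boundary_def)
    show "relatively_acyclic M (delete_simplices M {\<rho>})" if "\<rho> \<in> manifold_boundary M - {{}}" for \<rho>
    proof -
      have \<rho>: "\<rho> \<in> M" "has_homology_of_ball (link M \<rho>)"
        using that by (auto simp: manifold_boundary_def)
      then show ?thesis
        by (intro relatively_acyclic_delete_simplex M ball_cycles_subset_boundaries simplicial_complex_link)
    qed
    \<comment> \<open>The rim condition for \<open>\<rho>\<close> itself yields a
      \<open>\<tau>\<close> containing \<open>\<rho>\<close>, so every vertex of
      \<open>\<rho>\<close> passes the same test and is a boundary vertex.\<close>
    show "\<rho> \<subseteq> V" if \<rho>: "\<rho> \<in> manifold_boundary M - {{}}" for \<rho>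
    proof
      fix v assume v: "v \<in> \<rho>"
      have "\<rho> \<in> M"
        using \<rho> by (simp add: manifold_boundary_def)
      then obtain \<tau> where \<tau>: "\<And>\<alpha>. \<alpha> \<noteq> {} \<Longrightarrow> finite \<alpha> \<Longrightarrow>
          \<alpha> \<subseteq> \<rho> \<and> \<alpha> \<in> manifold_boundary M \<longleftrightarrow> \<alpha> \<subseteq> \<tau>"
        using rimmedD[OF M assms(2)] by metis
      have "\<rho> \<subseteq> \<tau>"
        using \<tau>[of \<rho>] \<rho> simplicial_complexD(2)[OF M \<open>\<rho> \<in> M\<close>] by simp
      then show "v \<in> V"
        using \<tau>[of "{v}"] v by (auto simp: V_def)
    qed
    \<comment> \<open>Each boundary vertex of \<open>\<sigma>\<close> lies in \<open>\<tau>\<close>,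
      so their whole set is a subset of \<open>\<tau>\<close> and hence a boundary face.\<close>
    show "\<sigma> \<inter> V \<in> manifold_boundary M - {{}}" if \<sigma>: "\<sigma> \<in> M" "\<sigma> \<inter> V \<noteq> {}" for \<sigma>
    proof -
      obtain \<tau> where \<tau>: "\<And>\<alpha>. \<alpha> \<noteq> {} \<Longrightarrow> finite \<alpha> \<Longrightarrow>
          \<alpha> \<subseteq> \<sigma> \<and> \<alpha> \<in> manifold_boundary M \<longleftrightarrow> \<alpha> \<subseteq> \<tau>"
        using rimmedD[OF M assms(2) \<sigma>(1)] by metis
      have "v \<in> \<tau>" if "v \<in> \<sigma> \<inter> V" for v
        using \<tau>[of "{v}"] that by (auto simp: V_def)
      then show ?thesis
        using \<tau>[of "\<sigma> \<inter> V"] \<sigma> simplicial_complexD(2)[OF M \<sigma>(1)] by blast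
    qed
    show "S \<subseteq> manifold_boundary M - {{}}"
      by (rule assms(3))
  qed
  then show ?thesis
    using L sub homology_inclusion_iso[OF L M sub] by blast
qed

end
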